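(* Let $\gamma\ge0$. In $\mathbf{Free}(G)$ with $G=\{\leftharpoonup_a,\rightharpoonup_a: a\in[\gamma]\}$, set $\prec_b:=\sum_{a\in[b]}\leftharpoonup_a$ and $\succ_b:=\sum_{a\in[b]}\rightharpoonup_a$ for $b\in[\gamma]$ (so $G'=\{\prec_b,\succ_b: b\in[\gamma]\}$ is a basis of $\mathbf{Free}(G)(2)$). Then $\mathsf{Dendr}_\gamma$ admits the presentation with generators $G'$ whose space of relations (which equals the space of relations $R$ of $\mathsf{Dendr}_\gamma$ below) is spanned by \begin{itemize} \item $\prec_a\circ_1\succ_{a'}-\succ_{a'}\circ_2\prec_a$, $a,a'\in[\gamma]$; \item $\prec_a\circ_1\prec_b-\prec_a\circ_2\succ_b-\prec_a\circ_2\prec_a$, $a<b\in[\gamma]$; \item $\succ_a\circ_1\succ_a+\succ_a\circ_1\prec_b-\succ_a\circ_2\succ_b$, $a<b\in[\gamma]$; \item $\prec_b\circ_1\prec_a-\prec_a\circ_2\prec_b-\prec_a\circ_2\succ_a$, $a<b\in[\gamma]$; \item $\succ_a\circ_1\prec_a+\succ_a\circ_1\succ_b-\succ_b\circ_2\succ_a$, $a<b\in[\gamma]$; \item $\prec_a\circ_1\prec_a-\prec_a\circ_2\succ_a-\prec_a\circ_2\prec_a$, $a\in[\gamma]$; \item $\succ_a\circ_1\succ_a+\succ_a\circ_1\prec_a-\succ_a\circ_2\succ_a$, $a\in[\gamma]$. \end{itemize}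
   Context: All operads are nonsymmetric operads over a field $\mathbb{K}$ of characteristic zero; $\mathbf{Free}(G)$ is the free nonsymmetric operad on a set $G$ of binary generators, and an operad with presentation $(G,R)$, $R\subseteq\mathbf{Free}(G)(3)$, is $\mathbf{Free}(G)/\langle R\rangle$. $[n]=\{1,\dots,n\}$. The operad $\mathsf{Dendr}_\gamma$ has presentation $(G,R)$ where $G=\{\leftharpoonup_a,\rightharpoonup_a:a\in[\gamma]\}$ and $R$ is spanned by: $\leftharpoonup_a\circ_1\rightharpoonup_{a'}-\rightharpoonup_{a'}\circ_2\leftharpoonup_a$ ($a,a'\in[\gamma]$); $\leftharpoonup_a\circ_1\leftharpoonup_b-\leftharpoonup_a\circ_2\rightharpoonup_b$, $\rightharpoonup_a\circ_1\leftharpoonup_b-\rightharpoonup_a\circ_2\rightharpoonup_b$, $\leftharpoonup_a\circ_1\leftharpoonup_b-\leftharpoonup_a\circ_2\leftharpoonup_b$, $\rightharpoonup_a\circ_1\rightharpoonup_b-\rightharpoonup_a\circ_2\rightharpoonup_b$ ($a<b\in[\gamma]$); $\leftharpoonup_d\circ_1\leftharpoonup_d-\sum_{c\in[d]}(\leftharpoonup_d\circ_2\leftharpoonup_c+\leftharpoonup_d\circ_2\rightharpoonup_c)$ and $\sum_{c\in[d]}(\rightharpoonup_d\circ_1\rightharpoonup_c+\rightharpoonup_d\circ_1\leftharpoonup_c)-\rightharpoonup_d\circ_2\rightharpoonup_d$ ($d\in[\gamma]$).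
   Formalization: The given relations ↼_a∘₁↼_b−↼_a∘₂↼_b and ⇀_a∘₁⇀_b−⇀_a∘₂⇀_b (a<b) of Dendr_γ, with which the claim fails for γ≥2, are corrected to ↼_b∘₁↼_a−↼_a∘₂↼_b and ⇀_a∘₁⇀_b−⇀_b∘₂⇀_a. *)

theory Defs
  imports Complex_Main "HOL-Library.Poly_Mapping" "HOL-Library.Tree"
begin

section \<open>Nonsymmetric operads\<close>

text \<open>
  The component of arity \<open>n\<close> is \<open>ops P n\<close>. In \<open>ocomp P m n i x y\<close>, the arguments \<open>m\<close> and \<open>n\<close> are
  the arities of \<open>x\<close> and \<open>y\<close>, and the result is the partial composition of \<open>y\<close> into the \<open>i\<close>-th
  input of \<open>x\<close>, where inputs are numbered from 1.
\<close>

record ('a, 'k) operad_data =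
  ops :: "nat \<Rightarrow> 'a set"
  ozero :: "nat \<Rightarrow> 'a"
  oadd :: "nat \<Rightarrow> 'a \<Rightarrow> 'a \<Rightarrow> 'a"
  oscale :: "nat \<Rightarrow> 'k \<Rightarrow> 'a \<Rightarrow> 'a"
  ounit :: 'a
  ocomp :: "nat \<Rightarrow> nat \<Rightarrow> nat \<Rightarrow> 'a \<Rightarrow> 'a \<Rightarrow> 'a"

locale ns_operad =
  fixes P :: "('a, 'k::field) operad_data"
  assumes zero_closed: "ozero P n \<in> ops P n"
    and add_closed: "\<lbrakk>x \<in> ops P n; y \<in> ops P n\<rbrakk> \<Longrightarrow> oadd P n x y \<in> ops P n"
    and scale_closed: "x \<in> ops P n \<Longrightarrow> oscale P n c x \<in> ops P n"
    and add_assoc: "\<lbrakk>x \<in> ops P n; y \<in> ops P n; z \<in> ops P n\<rbrakk> \<Longrightarrow>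
          oadd P n (oadd P n x y) z = oadd P n x (oadd P n y z)"
    and add_commute: "\<lbrakk>x \<in> ops P n; y \<in> ops P n\<rbrakk> \<Longrightarrow> oadd P n x y = oadd P n y x"
    and add_zero: "x \<in> ops P n \<Longrightarrow> oadd P n (ozero P n) x = x"
    and add_inverse: "x \<in> ops P n \<Longrightarrow> oadd P n (oscale P n (- 1) x) x = ozero P n"
    and scale_add: "\<lbrakk>x \<in> ops P n; y \<in> ops P n\<rbrakk> \<Longrightarrow>
          oscale P n c (oadd P n x y) = oadd P n (oscale P n c x) (oscale P n c y)"
    and add_scale: "x \<in> ops P n \<Longrightarrow>
          oscale P n (c + d) x = oadd P n (oscale P n c x) (oscale P n d x)"
    and scale_scale: "x \<in> ops P n \<Longrightarrow> oscale P n c (oscale P n d x) = oscale P n (c * d) x"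
    and scale_one: "x \<in> ops P n \<Longrightarrow> oscale P n 1 x = x"
    and unit_closed: "ounit P \<in> ops P 1"
    and comp_closed: "\<lbrakk>x \<in> ops P m; y \<in> ops P n; 1 \<le> i; i \<le> m\<rbrakk> \<Longrightarrow>
          ocomp P m n i x y \<in> ops P (m + n - 1)"
    and comp_add_left: "\<lbrakk>x \<in> ops P m; x' \<in> ops P m; y \<in> ops P n; 1 \<le> i; i \<le> m\<rbrakk> \<Longrightarrow>
          ocomp P m n i (oadd P m x x') y =
            oadd P (m + n - 1) (ocomp P m n i x y) (ocomp P m n i x' y)"
    and comp_add_right: "\<lbrakk>x \<in> ops P m; y \<in> ops P n; y' \<in> ops P n; 1 \<le> i; i \<le> m\<rbrakk> \<Longrightarrow>
          ocomp P m n i x (oadd P n y y') =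
            oadd P (m + n - 1) (ocomp P m n i x y) (ocomp P m n i x y')"
    and comp_scale_left: "\<lbrakk>x \<in> ops P m; y \<in> ops P n; 1 \<le> i; i \<le> m\<rbrakk> \<Longrightarrow>
          ocomp P m n i (oscale P m c x) y = oscale P (m + n - 1) c (ocomp P m n i x y)"
    and comp_scale_right: "\<lbrakk>x \<in> ops P m; y \<in> ops P n; 1 \<le> i; i \<le> m\<rbrakk> \<Longrightarrow>
          ocomp P m n i x (oscale P n c y) = oscale P (m + n - 1) c (ocomp P m n i x y)"
    and comp_unit_left: "x \<in> ops P n \<Longrightarrow> ocomp P 1 n 1 (ounit P) x = x"
    and comp_unit_right: "\<lbrakk>x \<in> ops P n; 1 \<le> i; i \<le> n\<rbrakk> \<Longrightarrow> ocomp P n 1 i x (ounit P) = x"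
    and comp_sequential: "\<lbrakk>x \<in> ops P m; y \<in> ops P n; z \<in> ops P l; 1 \<le> i; i \<le> m; 1 \<le> j; j \<le> n\<rbrakk> \<Longrightarrow>
          ocomp P (m + n - 1) l (i + j - 1) (ocomp P m n i x y) z =
            ocomp P m (n + l - 1) i x (ocomp P n l j y z)"
    and comp_parallel: "\<lbrakk>x \<in> ops P m; y \<in> ops P n; z \<in> ops P l; 1 \<le> i; i < j; j \<le> m\<rbrakk> \<Longrightarrow>
          ocomp P (m + n - 1) l (j + n - 1) (ocomp P m n i x y) z =
            ocomp P (m + l - 1) n i (ocomp P m l j x z) y"

definition operad_iso ::
  "(nat \<Rightarrow> 'a \<Rightarrow> 'b) \<Rightarrow> ('a, 'k) operad_data \<Rightarrow> ('b, 'k) operad_data \<Rightarrow> bool"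
where
  "operad_iso \<Phi> P Q \<longleftrightarrow>
     (\<forall>n. bij_betw (\<Phi> n) (ops P n) (ops Q n)) \<and>
     (\<forall>n. \<forall>x \<in> ops P n. \<forall>y \<in> ops P n. \<Phi> n (oadd P n x y) = oadd Q n (\<Phi> n x) (\<Phi> n y)) \<and>
     (\<forall>n c. \<forall>x \<in> ops P n. \<Phi> n (oscale P n c x) = oscale Q n c (\<Phi> n x)) \<and>
     \<Phi> 1 (ounit P) = ounit Q \<and>
     (\<forall>m n i. \<forall>x \<in> ops P m. \<forall>y \<in> ops P n. 1 \<le> i \<and> i \<le> m \<longrightarrow>
        \<Phi> (m + n - 1) (ocomp P m n i x y) = ocomp Q m n i (\<Phi> m x) (\<Phi> n y))"

definition operad_ideal :: "('a, 'k) operad_data \<Rightarrow> (nat \<Rightarrow> 'a set) \<Rightarrow> bool" where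
  "operad_ideal P I \<longleftrightarrow>
     (\<forall>n. I n \<subseteq> ops P n \<and> ozero P n \<in> I n) \<and>
     (\<forall>n. \<forall>x \<in> I n. \<forall>y \<in> I n. oadd P n x y \<in> I n) \<and>
     (\<forall>n c. \<forall>x \<in> I n. oscale P n c x \<in> I n) \<and>
     (\<forall>m n i. \<forall>x \<in> ops P m. \<forall>y \<in> ops P n. 1 \<le> i \<and> i \<le> m \<and> (x \<in> I m \<or> y \<in> I n) \<longrightarrow>
        ocomp P m n i x y \<in> I (m + n - 1))"

definition generated_ideal :: "('a, 'k) operad_data \<Rightarrow> 'a set \<Rightarrow> nat \<Rightarrow> 'a set" where
  \<comment> \<open>\<open>R\<close> is a set of elements of arity 3.\<close>
  "generated_ideal P R n = \<Inter>{I n |I. operad_ideal P I \<and> R \<subseteq> I 3}"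

definition operad_coset :: "('a, 'k) operad_data \<Rightarrow> (nat \<Rightarrow> 'a set) \<Rightarrow> nat \<Rightarrow> 'a \<Rightarrow> 'a set" where
  "operad_coset P I n x = oadd P n x ` I n"

text \<open>
  As for factor rings, operations on cosets are unions over all representatives; for an ideal, all
  the cosets in such a union coincide.
\<close>

definition quotient_operad ::
  "('a, 'k) operad_data \<Rightarrow> (nat \<Rightarrow> 'a set) \<Rightarrow> ('a set, 'k) operad_data"
where
  "quotient_operad P I =
     \<lparr>ops = (\<lambda>n. operad_coset P I n ` ops P n),
      ozero = (\<lambda>n. operad_coset P I n (ozero P n)),
      oadd = (\<lambda>n X Y. \<Union>x\<in>X. \<Union>y\<in>Y. operad_coset P I n (oadd P n x y)),
      oscale = (\<lambda>n c X. \<Union>x\<in>X. operad_coset P I n (oscale P n c x)),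
      ounit = operad_coset P I 1 (ounit P),
      ocomp = (\<lambda>m n i X Y. \<Union>x\<in>X. \<Union>y\<in>Y. operad_coset P I (m + n - 1) (ocomp P m n i x y))\<rparr>"


section \<open>Free nonsymmetric operads on binary generators\<close>

text \<open>
  A basis of the free operad on a set of binary generators consists of the binary trees whose
  internal nodes are labelled by generators. The arity of a tree is its number of leaves
  \<^const>\<open>size1\<close>, and its leaves are numbered from left to right.
\<close>

fun graft :: "'g tree \<Rightarrow> nat \<Rightarrow> 'g tree \<Rightarrow> 'g tree" where
  "graft \<langle>\<rangle> i s = s"
| "graft \<langle>l, g, r\<rangle> i s =
     (if i \<le> size1 l then \<langle>graft l i s, g, r\<rangle> else \<langle>l, g, graft r (i - size1 l) s\<rangle>)"

definition lscale :: "'k::field \<Rightarrow> ('t \<Rightarrow>\<^sub>0 'k) \<Rightarrow> ('t \<Rightarrow>\<^sub>0 'k)" where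
  "lscale c x = Poly_Mapping.map ((*) c) x"

lemma lookup_lscale [simp]: "Poly_Mapping.lookup (lscale c x) t = c * Poly_Mapping.lookup x t"
  by (simp add: lscale_def Poly_Mapping.map.rep_eq when_def)

global_interpretation lincomb: vector_space "lscale :: 'k::field \<Rightarrow> ('t \<Rightarrow>\<^sub>0 'k) \<Rightarrow> ('t \<Rightarrow>\<^sub>0 'k)"
  by unfold_locales (auto intro!: poly_mapping_eqI simp: lookup_add algebra_simps)

definition tree_comp ::
  "('g tree \<Rightarrow>\<^sub>0 'k::field) \<Rightarrow> nat \<Rightarrow> ('g tree \<Rightarrow>\<^sub>0 'k) \<Rightarrow> ('g tree \<Rightarrow>\<^sub>0 'k)"
  (\<open>_ \<circ>\<^bsub>_\<^esub> _\<close> [71, 0, 71] 70)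
where
  "x \<circ>\<^bsub>i\<^esub> y = (\<Sum>t\<in>Poly_Mapping.keys x. \<Sum>s\<in>Poly_Mapping.keys y.
     Poly_Mapping.single (graft t i s) (Poly_Mapping.lookup x t * Poly_Mapping.lookup y s))"

definition free_operad :: "'g set \<Rightarrow> ('g tree \<Rightarrow>\<^sub>0 'k::field, 'k) operad_data" where
  "free_operad G =
     \<lparr>ops = (\<lambda>n. {x. \<forall>t \<in> Poly_Mapping.keys x. size1 t = n \<and> set_tree t \<subseteq> G}),
      ozero = (\<lambda>n. 0),
      oadd = (\<lambda>n. (+)),
      oscale = (\<lambda>n. lscale),
      ounit = Poly_Mapping.single \<langle>\<rangle> 1,
      ocomp = (\<lambda>m n i x y. x \<circ>\<^bsub>i\<^esub> y)\<rparr>"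

definition corolla :: "'g \<Rightarrow> ('g tree \<Rightarrow>\<^sub>0 'k::field)" where
  "corolla g = Poly_Mapping.single \<langle>\<langle>\<rangle>, g, \<langle>\<rangle>\<rangle> 1"

definition presented_operad ::
  "'g set \<Rightarrow> ('g tree \<Rightarrow>\<^sub>0 'k::field) set \<Rightarrow> (('g tree \<Rightarrow>\<^sub>0 'k) set, 'k) operad_data"
where
  "presented_operad G R = quotient_operad (free_operad G) (generated_ideal (free_operad G) R)"

definition presented_class ::
  "'g set \<Rightarrow> ('g tree \<Rightarrow>\<^sub>0 'k::field) set \<Rightarrow> nat \<Rightarrow> ('g tree \<Rightarrow>\<^sub>0 'k) \<Rightarrow> ('g tree \<Rightarrow>\<^sub>0 'k) set"
where
  "presented_class G R n x = operad_coset (free_operad G) (generated_ideal (free_operad G) R) n x"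

lemma tree_comp_superset:
  assumes "finite A" "Poly_Mapping.keys x \<subseteq> A" "finite B" "Poly_Mapping.keys y \<subseteq> B"
  shows "x \<circ>\<^bsub>i\<^esub> y = (\<Sum>t\<in>A. \<Sum>s\<in>B.
     Poly_Mapping.single (graft t i s) (Poly_Mapping.lookup x t * Poly_Mapping.lookup y s))"
proof -
  have "x \<circ>\<^bsub>i\<^esub> y = (\<Sum>t\<in>Poly_Mapping.keys x. \<Sum>s\<in>B.
     Poly_Mapping.single (graft t i s) (Poly_Mapping.lookup x t * Poly_Mapping.lookup y s))"
    unfolding tree_comp_def
    by (intro sum.cong refl sum.mono_neutral_left assms) (auto simp: in_keys_iff)
  also have "\<dots> = (\<Sum>t\<in>A. \<Sum>s\<in>B.
     Poly_Mapping.single (graft t i s) (Poly_Mapping.lookup x t * Poly_Mapping.lookup y s))"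
    by (intro sum.mono_neutral_left assms) (auto simp: in_keys_iff)
  finally show ?thesis .
qed

lemma tree_comp_add_left: "(x + x') \<circ>\<^bsub>i\<^esub> y = x \<circ>\<^bsub>i\<^esub> y + x' \<circ>\<^bsub>i\<^esub> y"
proof -
  let ?A = "Poly_Mapping.keys x \<union> Poly_Mapping.keys x'" and ?B = "Poly_Mapping.keys y"
  have "Poly_Mapping.keys (x + x') \<subseteq> ?A" by (rule keys_add)
  then show ?thesis
    by (simp add: tree_comp_superset[of ?A _ ?B] lookup_add distrib_right single_add sum.distrib)
qed

lemma tree_comp_add_right: "x \<circ>\<^bsub>i\<^esub> (y + y') = x \<circ>\<^bsub>i\<^esub> y + x \<circ>\<^bsub>i\<^esub> y'"
proof -
  let ?A = "Poly_Mapping.keys x" and ?B = "Poly_Mapping.keys y \<union> Poly_Mapping.keys y'"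
  have "Poly_Mapping.keys (y + y') \<subseteq> ?B" by (rule keys_add)
  then show ?thesis
    by (simp add: tree_comp_superset[of ?A _ ?B] lookup_add distrib_left single_add sum.distrib)
qed

lemma lscale_single: "lscale c (Poly_Mapping.single t a) = Poly_Mapping.single t (c * a)"
  by (rule poly_mapping_eqI) (simp add: lookup_single when_def)

lemma keys_lscale: "Poly_Mapping.keys (lscale c x) \<subseteq> Poly_Mapping.keys x"
  by (auto simp: in_keys_iff)

lemma tree_comp_lscale_left: "lscale c x \<circ>\<^bsub>i\<^esub> y = lscale c (x \<circ>\<^bsub>i\<^esub> y)"
  using keys_lscale[of c x]
  by (simp add: tree_comp_superset[of "Poly_Mapping.keys x" _ "Poly_Mapping.keys y"]
      lincomb.scale_sum_right lscale_single mult.assoc)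

lemma tree_comp_lscale_right: "x \<circ>\<^bsub>i\<^esub> lscale c y = lscale c (x \<circ>\<^bsub>i\<^esub> y)"
  using keys_lscale[of c y]
  by (simp add: tree_comp_superset[of "Poly_Mapping.keys x" _ "Poly_Mapping.keys y"]
      lincomb.scale_sum_right lscale_single mult.left_commute)

lemma tree_comp_zero [simp]: "0 \<circ>\<^bsub>i\<^esub> y = 0" "x \<circ>\<^bsub>i\<^esub> 0 = 0"
  by (simp_all add: tree_comp_def)

lemma tree_comp_single:
  "Poly_Mapping.single t a \<circ>\<^bsub>i\<^esub> Poly_Mapping.single s b = Poly_Mapping.single (graft t i s) (a * b)"
  by (simp add: tree_comp_superset[of "{t}" _ "{s}"])

lemma free_operad_induct [consumes 1, case_names zero single add]:
  assumes x: "x \<in> ops (free_operad G) n"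
    and zero: "Q 0"
    and single: "\<And>t a. \<lbrakk>size1 t = n; set_tree t \<subseteq> G\<rbrakk> \<Longrightarrow> Q (Poly_Mapping.single t a)"
    and add: "\<And>x y. \<lbrakk>Q x; Q y\<rbrakk> \<Longrightarrow> Q (x + y)"
  shows "Q (x :: 'g tree \<Rightarrow>\<^sub>0 'k::field)"
proof -
  have sum_single: "x = (\<Sum>t\<in>Poly_Mapping.keys x. Poly_Mapping.single t (Poly_Mapping.lookup x t))"
    by (rule poly_mapping_eqI) (auto simp: lookup_sum lookup_single when_def in_keys_iff)
  have "Q (\<Sum>t\<in>A. Poly_Mapping.single t (Poly_Mapping.lookup x t))"
    if "finite A" "A \<subseteq> Poly_Mapping.keys x" for A
    using that
  proof (induction A rule: finite_induct)
    case (insert t A)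
    then show ?case using x by (auto simp: free_operad_def intro!: add single)
  qed (simp add: zero)
  from this[of "Poly_Mapping.keys x"] show ?thesis
    by (subst sum_single) simp
qed

lemma size1_graft: "\<lbrakk>1 \<le> i; i \<le> size1 t\<rbrakk> \<Longrightarrow> size1 (graft t i s) = size1 t + size1 s - 1"
  by (induction t arbitrary: i) (auto simp: Suc_le_eq)

lemma set_tree_graft: "set_tree (graft t i s) \<subseteq> set_tree t \<union> set_tree s"
  by (induction t arbitrary: i) auto

lemma graft_Leaf: "\<lbrakk>1 \<le> i; i \<le> size1 t\<rbrakk> \<Longrightarrow> graft t i \<langle>\<rangle> = t"
  by (induction t arbitrary: i) auto

lemma graft_sequential:
  "\<lbrakk>1 \<le> i; i \<le> size1 t; 1 \<le> j; j \<le> size1 s\<rbrakk> \<Longrightarrow>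
     graft (graft t i s) (i + j - 1) u = graft t i (graft s j u)"
proof (induction t arbitrary: i)
  case (Node l g r)
  show ?case
  proof (cases "i \<le> size1 l")
    case True
    then show ?thesis using Node by (auto simp: size1_graft)
  next
    case False
    then have "i + j - 1 - size1 l = (i - size1 l) + j - 1" by simp
    with False show ?thesis using Node.IH(2)[of "i - size1 l"] Node.prems by auto
  qed
qed simp

lemma graft_parallel:
  "\<lbrakk>1 \<le> i; i < j; j \<le> size1 t\<rbrakk> \<Longrightarrow>
     graft (graft t i s) (j + size1 s - 1) u = graft (graft t j u) i s"
proof (induction t arbitrary: i j)
  case (Node l g r)
  have pos: "1 \<le> size1 s" by (simp add: Suc_le_eq)
  consider "j \<le> size1 l" | "i \<le> size1 l" "size1 l < j" | "size1 l < i" by linarith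
  then show ?case
  proof cases
    case 1
    then have "i \<le> size1 (graft l j u)" using Node.prems size1_ge0[of u]
      by (auto simp: size1_graft simp del: size1_ge0)
    with 1 show ?thesis using Node.IH(1)[of i j] Node.prems pos by (auto simp: size1_graft)
  next
    case 2
    then have "j + size1 s - 1 - (size1 l + size1 s - 1) = j - size1 l" using pos by linarith
    with 2 show ?thesis using Node.prems pos by (auto simp: size1_graft)
  next
    case 3
    then have "j + size1 s - 1 - size1 l = (j - size1 l) + size1 s - 1" using Node.prems by simp
    with 3 show ?thesis
      using Node.IH(2)[of "i - size1 l" "j - size1 l"] Node.prems pos by auto
  qed
qed simp

lemma free_operad_add_closed:
  "\<lbrakk>x \<in> ops (free_operad G) n; y \<in> ops (free_operad G) n\<rbrakk> \<Longrightarrow> x + y \<in> ops (free_operad G) n"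
  using keys_add[of x y] by (auto simp: free_operad_def)

lemma tree_comp_closed:
  assumes "x \<in> ops (free_operad G) m" "y \<in> ops (free_operad G) n" "1 \<le> i" "i \<le> m"
  shows "x \<circ>\<^bsub>i\<^esub> y \<in> ops (free_operad G) (m + n - 1)"
proof -
  have zero_closed: "0 \<in> ops (free_operad G) k" for k
    by (simp add: free_operad_def)
  have sum_closed: "sum f A \<in> ops (free_operad G) k"
    if "\<And>t. t \<in> A \<Longrightarrow> f t \<in> ops (free_operad G) k" for f :: "'c \<Rightarrow> 'a tree \<Rightarrow>\<^sub>0 'b" and A k
    using that
    by (induction A rule: infinite_finite_induct)
       (auto intro: free_operad_add_closed simp: zero_closed)
  show ?thesis
    unfolding tree_comp_def
  proof (intro sum_closed)
    fix t s assume "t \<in> Poly_Mapping.keys x" "s \<in> Poly_Mapping.keys y"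
    then have "size1 t = m" "size1 s = n" "set_tree t \<subseteq> G" "set_tree s \<subseteq> G"
      using assms by (auto simp: free_operad_def)
    then have "size1 (graft t i s) = m + n - 1" "set_tree (graft t i s) \<subseteq> G"
      using assms(3,4) size1_graft[of i t s] set_tree_graft[of t i s] by auto
    then show "Poly_Mapping.single (graft t i s) (Poly_Mapping.lookup x t * Poly_Mapping.lookup y s)
        \<in> ops (free_operad G) (m + n - 1)"
      by (simp add: free_operad_def)
  qed
qed

lemma ns_operad_free_operad: "ns_operad (free_operad G :: ('g tree \<Rightarrow>\<^sub>0 'k::field, 'k) operad_data)"
proof -
  let ?F = "free_operad G :: ('g tree \<Rightarrow>\<^sub>0 'k, 'k) operad_data"
  have unit_left: "Poly_Mapping.single \<langle>\<rangle> 1 \<circ>\<^bsub>1\<^esub> x = x" if "x \<in> ops ?F n" for x n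
    using that by (induction rule: free_operad_induct) (simp_all add: tree_comp_single tree_comp_add_right)
  have unit_right: "x \<circ>\<^bsub>i\<^esub> Poly_Mapping.single \<langle>\<rangle> 1 = x" if "x \<in> ops ?F n" "1 \<le> i" "i \<le> n" for x n i
    using that
    by (induction rule: free_operad_induct) (simp_all add: tree_comp_single tree_comp_add_left graft_Leaf)
  have sequential: "(x \<circ>\<^bsub>i\<^esub> y) \<circ>\<^bsub>i + j - 1\<^esub> z = x \<circ>\<^bsub>i\<^esub> (y \<circ>\<^bsub>j\<^esub> z)"
    if x: "x \<in> ops ?F m" and y: "y \<in> ops ?F n" and z: "z \<in> ops ?F l"
      and ij: "1 \<le> i" "i \<le> m" "1 \<le> j" "j \<le> n" for x y z m n l i j
    using x
  proof (induction rule: free_operad_induct)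
    case (single t a)
    note t = single
    from y show ?case
    proof (induction rule: free_operad_induct)
      case (single s b)
      note s = single
      from z show ?case
        by (induction rule: free_operad_induct)
           (use t s ij in \<open>simp_all add: tree_comp_single tree_comp_add_right graft_sequential mult.assoc
              del: One_nat_def\<close>)
    qed (simp_all add: tree_comp_add_left tree_comp_add_right)
  qed (simp_all add: tree_comp_add_left)
  have parallel: "(x \<circ>\<^bsub>i\<^esub> y) \<circ>\<^bsub>j + n - 1\<^esub> z = (x \<circ>\<^bsub>j\<^esub> z) \<circ>\<^bsub>i\<^esub> y"
    if x: "x \<in> ops ?F m" and y: "y \<in> ops ?F n" and z: "z \<in> ops ?F l"
      and ij: "1 \<le> i" "i < j" "j \<le> m" for x y z m n l i j
    using x
  proof (induction rule: free_operad_induct)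
    case (single t a)
    note t = single
    from y show ?case
    proof (induction rule: free_operad_induct)
      case (single s b)
      note s = single
      from z show ?case
      proof (induction rule: free_operad_induct)
        case (single u c)
        have "graft (graft t i s) (j + n - 1) u = graft (graft t j u) i s"
          using graft_parallel[of i j t s u] t s ij by simp
        then show ?case by (simp add: tree_comp_single mult.assoc mult.commute[of b])
      qed (simp_all add: tree_comp_add_left tree_comp_add_right)
    qed (simp_all add: tree_comp_add_left tree_comp_add_right)
  qed (simp_all add: tree_comp_add_left)
  have data: "ozero ?F n = 0" "oadd ?F n = (+)" "oscale ?F n = lscale"
    "ounit ?F = Poly_Mapping.single \<langle>\<rangle> 1" "ocomp ?F m n i x y = x \<circ>\<^bsub>i\<^esub> y" for m n i x y
    by (simp_all add: free_operad_def)
  have closed: "0 \<in> ops ?F n" "Poly_Mapping.single \<langle>\<rangle> 1 \<in> ops ?F 1" for n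
    by (simp_all add: free_operad_def)
  have scale_closed: "lscale c x \<in> ops ?F n" if "x \<in> ops ?F n" for c x n
    using that keys_lscale[of c x] by (auto simp: free_operad_def)
  show ?thesis
    by (unfold_locales; unfold data)
       ((rule closed free_operad_add_closed scale_closed tree_comp_closed unit_left unit_right sequential parallel
          tree_comp_add_left tree_comp_add_right tree_comp_lscale_left tree_comp_lscale_right
          add.assoc add.commute add_0_left lincomb.scale_right_distrib lincomb.scale_left_distrib
          lincomb.scale_scale lincomb.scale_one; assumption)
        | simp)+
qed

section \<open>The operads \<open>Dendr\<^sub>\<gamma>\<close>\<close>

datatype dendr_gen = LHarp nat | RHarp nat

definition dendr_gens :: "nat \<Rightarrow> dendr_gen set" where
  "dendr_gens \<gamma> = LHarp ` {1..\<gamma>} \<union> RHarp ` {1..\<gamma>}"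

abbreviation lh :: "nat \<Rightarrow> (dendr_gen tree \<Rightarrow>\<^sub>0 'k::field)" where
  "lh a \<equiv> corolla (LHarp a)"

abbreviation rh :: "nat \<Rightarrow> (dendr_gen tree \<Rightarrow>\<^sub>0 'k::field)" where
  "rh a \<equiv> corolla (RHarp a)"

text \<open>
  In the fourth and fifth families, the order of the indices matters: the relations are the Koszul
  duals of \<open>\<stileturn>\<^sub>b \<circ>\<^sub>1 \<stileturn>\<^sub>a = \<stileturn>\<^sub>a \<circ>\<^sub>2 \<stileturn>\<^sub>b\<close> and \<open>\<turnstile>\<^sub>a \<circ>\<^sub>1 \<turnstile>\<^sub>b = \<turnstile>\<^sub>b \<circ>\<^sub>2 \<turnstile>\<^sub>a\<close> (\<open>a < b\<close>). With
  \<open>lh a \<circ>\<^bsub>1\<^esub> lh b - lh a \<circ>\<^bsub>2\<^esub> lh b\<close> and \<open>rh a \<circ>\<^bsub>1\<^esub> rh b - rh a \<circ>\<^bsub>2\<^esub> rh b\<close> instead, the relation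
  space would contain \<open>lh a \<circ>\<^bsub>2\<^esub> rh b - lh a \<circ>\<^bsub>2\<^esub> lh b\<close>, and for \<open>\<gamma> \<ge> 2\<close> it would differ from the
  space \<open>dendr_relations' \<gamma> prec succ\<close> defined below.
\<close>

definition dendr_relations :: "nat \<Rightarrow> (dendr_gen tree \<Rightarrow>\<^sub>0 'k::field) set" where
  "dendr_relations \<gamma> = lincomb.span (
     {lh a \<circ>\<^bsub>1\<^esub> rh a' - rh a' \<circ>\<^bsub>2\<^esub> lh a |a a'. a \<in> {1..\<gamma>} \<and> a' \<in> {1..\<gamma>}} \<union>
     {lh a \<circ>\<^bsub>1\<^esub> lh b - lh a \<circ>\<^bsub>2\<^esub> rh b |a b. a \<in> {1..\<gamma>} \<and> b \<in> {1..\<gamma>} \<and> a < b} \<union>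
     {rh a \<circ>\<^bsub>1\<^esub> lh b - rh a \<circ>\<^bsub>2\<^esub> rh b |a b. a \<in> {1..\<gamma>} \<and> b \<in> {1..\<gamma>} \<and> a < b} \<union>
     {lh b \<circ>\<^bsub>1\<^esub> lh a - lh a \<circ>\<^bsub>2\<^esub> lh b |a b. a \<in> {1..\<gamma>} \<and> b \<in> {1..\<gamma>} \<and> a < b} \<union>
     {rh a \<circ>\<^bsub>1\<^esub> rh b - rh b \<circ>\<^bsub>2\<^esub> rh a |a b. a \<in> {1..\<gamma>} \<and> b \<in> {1..\<gamma>} \<and> a < b} \<union>
     {lh d \<circ>\<^bsub>1\<^esub> lh d - (\<Sum>c\<in>{1..d}. lh d \<circ>\<^bsub>2\<^esub> lh c + lh d \<circ>\<^bsub>2\<^esub> rh c) |d. d \<in> {1..\<gamma>}} \<union>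
     {(\<Sum>c\<in>{1..d}. rh d \<circ>\<^bsub>1\<^esub> rh c + rh d \<circ>\<^bsub>1\<^esub> lh c) - rh d \<circ>\<^bsub>2\<^esub> rh d |d. d \<in> {1..\<gamma>}})"

definition Dendr :: "nat \<Rightarrow> ((dendr_gen tree \<Rightarrow>\<^sub>0 'k::field) set, 'k) operad_data" where
  "Dendr \<gamma> = presented_operad (dendr_gens \<gamma>) (dendr_relations \<gamma>)"

definition prec :: "nat \<Rightarrow> (dendr_gen tree \<Rightarrow>\<^sub>0 'k::field)" where
  "prec b = (\<Sum>a\<in>{1..b}. lh a)"

definition succ :: "nat \<Rightarrow> (dendr_gen tree \<Rightarrow>\<^sub>0 'k::field)" where
  "succ b = (\<Sum>a\<in>{1..b}. rh a)"

definition dendr_gens' :: "nat \<Rightarrow> (dendr_gen tree \<Rightarrow>\<^sub>0 'k::field) set" where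
  "dendr_gens' \<gamma> = prec ` {1..\<gamma>} \<union> succ ` {1..\<gamma>}"

text \<open>
  The families \<open>p\<close> and \<open>s\<close> stand for the operations \<open>\<prec>\<close> and \<open>\<succ>\<close>. They are instantiated both with the
  elements \<^const>\<open>prec\<close> and \<^const>\<open>succ\<close> of the free operad on \<^const>\<open>dendr_gens\<close> and with the
  generators of the free operad on \<^const>\<open>dendr_gens'\<close>.
\<close>

definition dendr_relations' ::
  "nat \<Rightarrow> (nat \<Rightarrow> ('g tree \<Rightarrow>\<^sub>0 'k::field)) \<Rightarrow> (nat \<Rightarrow> ('g tree \<Rightarrow>\<^sub>0 'k)) \<Rightarrow> ('g tree \<Rightarrow>\<^sub>0 'k) set"
where
  "dendr_relations' \<gamma> p s = lincomb.span (
     {p a \<circ>\<^bsub>1\<^esub> s a' - s a' \<circ>\<^bsub>2\<^esub> p a |a a'. a \<in> {1..\<gamma>} \<and> a' \<in> {1..\<gamma>}} \<union>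
     {p a \<circ>\<^bsub>1\<^esub> p b - p a \<circ>\<^bsub>2\<^esub> s b - p a \<circ>\<^bsub>2\<^esub> p a |a b. a \<in> {1..\<gamma>} \<and> b \<in> {1..\<gamma>} \<and> a < b} \<union>
     {s a \<circ>\<^bsub>1\<^esub> s a + s a \<circ>\<^bsub>1\<^esub> p b - s a \<circ>\<^bsub>2\<^esub> s b |a b. a \<in> {1..\<gamma>} \<and> b \<in> {1..\<gamma>} \<and> a < b} \<union>
     {p b \<circ>\<^bsub>1\<^esub> p a - p a \<circ>\<^bsub>2\<^esub> p b - p a \<circ>\<^bsub>2\<^esub> s a |a b. a \<in> {1..\<gamma>} \<and> b \<in> {1..\<gamma>} \<and> a < b} \<union>
     {s a \<circ>\<^bsub>1\<^esub> p a + s a \<circ>\<^bsub>1\<^esub> s b - s b \<circ>\<^bsub>2\<^esub> s a |a b. a \<in> {1..\<gamma>} \<and> b \<in> {1..\<gamma>} \<and> a < b} \<union>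
     {p a \<circ>\<^bsub>1\<^esub> p a - p a \<circ>\<^bsub>2\<^esub> s a - p a \<circ>\<^bsub>2\<^esub> p a |a. a \<in> {1..\<gamma>}} \<union>
     {s a \<circ>\<^bsub>1\<^esub> s a + s a \<circ>\<^bsub>1\<^esub> p a - s a \<circ>\<^bsub>2\<^esub> s a |a. a \<in> {1..\<gamma>}})"

end

theory Submission
  imports Defs
begin

text \<open>
  With \<open>m = min a b\<close>, the proposed relations say that \<open>\<prec>\<^sub>a \<circ>\<^sub>1 \<prec>\<^sub>b = \<prec>\<^sub>m \<circ>\<^sub>2 (\<prec>\<^sub>a + \<succ>\<^sub>b)\<close>,
  \<open>\<succ>\<^sub>a \<circ>\<^sub>2 \<succ>\<^sub>b = \<succ>\<^sub>m \<circ>\<^sub>1 (\<succ>\<^sub>a + \<prec>\<^sub>b)\<close> and \<open>\<prec>\<^sub>a \<circ>\<^sub>1 \<succ>\<^sub>b = \<succ>\<^sub>b \<circ>\<^sub>2 \<prec>\<^sub>a\<close> for all \<open>a\<close> and \<open>b\<close>. The mixed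
  second differences of these three families in \<open>(a, b)\<close> are exactly the defining relations of
  \<open>Dendr\<^sub>\<gamma>\<close>, and both sides vanish for \<open>a = 0\<close> or \<open>b = 0\<close>; hence the two relation spaces agree.
  Substituting generators by elements of arity 2 gives an operad morphism between free operads.
  The substitution on \<open>G'\<close> is inverted by \<open>\<leftharpoonup>\<^sub>a \<mapsto> \<prec>\<^sub>a - \<prec>\<^sub>a\<^sub>-\<^sub>1\<close>, \<open>\<rightharpoonup>\<^sub>a \<mapsto> \<succ>\<^sub>a - \<succ>\<^sub>a\<^sub>-\<^sub>1\<close>, and an isomorphism
  descends to the quotients by corresponding ideals.
\<close>

section \<open>Isomorphisms and quotients\<close>

lemma operad_isoD:
  assumes "operad_iso \<Phi> P Q"
  shows "bij_betw (\<Phi> n) (ops P n) (ops Q n)"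
    and "\<lbrakk>x \<in> ops P n; y \<in> ops P n\<rbrakk> \<Longrightarrow> \<Phi> n (oadd P n x y) = oadd Q n (\<Phi> n x) (\<Phi> n y)"
    and "x \<in> ops P n \<Longrightarrow> \<Phi> n (oscale P n c x) = oscale Q n c (\<Phi> n x)"
    and "\<Phi> 1 (ounit P) = ounit Q"
    and "\<lbrakk>x \<in> ops P m; y \<in> ops P n; 1 \<le> i; i \<le> m\<rbrakk> \<Longrightarrow>
      \<Phi> (m + n - 1) (ocomp P m n i x y) = ocomp Q m n i (\<Phi> m x) (\<Phi> n y)"
  using assms unfolding operad_iso_def by blast+

lemma operad_iso_closed:
  "\<lbrakk>operad_iso \<Phi> P Q; x \<in> ops P n\<rbrakk> \<Longrightarrow> \<Phi> n x \<in> ops Q n"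
  using operad_isoD(1) bij_betwE by blast

lemma operad_iso_zero:
  assumes "operad_iso \<Phi> P Q" "ns_operad P" "ns_operad Q"
  shows "\<Phi> n (ozero P n) = ozero Q n"
proof -
  interpret P: ns_operad P by fact
  interpret Q: ns_operad Q by fact
  note iso = operad_isoD[OF assms(1)]
  let ?z = "ozero P n"
  have "\<Phi> n ?z = \<Phi> n (oadd P n (oscale P n (- 1) ?z) ?z)"
    by (simp add: P.add_inverse P.zero_closed)
  also have "\<dots> = oadd Q n (oscale Q n (- 1) (\<Phi> n ?z)) (\<Phi> n ?z)"
    by (simp add: iso P.zero_closed P.scale_closed)
  also have "\<dots> = ozero Q n"
    by (intro Q.add_inverse operad_iso_closed[OF assms(1)] P.zero_closed)
  finally show ?thesis .
qed

lemma operad_ideal_ops: "ns_operad P \<Longrightarrow> operad_ideal P (ops P)"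
  unfolding operad_ideal_def
  by (auto intro: ns_operad.zero_closed ns_operad.add_closed ns_operad.scale_closed
      ns_operad.comp_closed[simplified])

lemma generated_ideal_subset:
  "\<lbrakk>ns_operad P; R \<subseteq> ops P 3\<rbrakk> \<Longrightarrow> generated_ideal P R n \<subseteq> ops P n"
  using operad_ideal_ops unfolding generated_ideal_def by blast

lemma operad_ideal_vimage:
  assumes iso: "operad_iso \<Phi> P Q" and P: "ns_operad P" and Q: "ns_operad Q"
    and J: "operad_ideal Q J"
  shows "operad_ideal P (\<lambda>n. {x \<in> ops P n. \<Phi> n x \<in> J n})"
proof -
  interpret P: ns_operad P by fact
  note J' = J[unfolded operad_ideal_def]
  show ?thesis
    unfolding operad_ideal_def
  proof (intro conjI allI ballI impI)
    fix n show "ozero P n \<in> {x \<in> ops P n. \<Phi> n x \<in> J n}"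
      using J' by (simp add: P.zero_closed operad_iso_zero[OF iso P Q])
  next
    fix n x y assume "x \<in> {x \<in> ops P n. \<Phi> n x \<in> J n}" "y \<in> {x \<in> ops P n. \<Phi> n x \<in> J n}"
    then show "oadd P n x y \<in> {x \<in> ops P n. \<Phi> n x \<in> J n}"
      using J' by (simp add: P.add_closed operad_isoD(2)[OF iso])
  next
    fix n c x assume "x \<in> {x \<in> ops P n. \<Phi> n x \<in> J n}"
    then show "oscale P n c x \<in> {x \<in> ops P n. \<Phi> n x \<in> J n}"
      using J' by (simp add: P.scale_closed operad_isoD(3)[OF iso])
  next
    fix m n i x y
    assume *: "x \<in> ops P m" "y \<in> ops P n"
      "1 \<le> i \<and> i \<le> m \<and> (x \<in> {x \<in> ops P m. \<Phi> m x \<in> J m} \<or> y \<in> {x \<in> ops P n. \<Phi> n x \<in> J n})"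
    then have "\<Phi> m x \<in> ops Q m" "\<Phi> n y \<in> ops Q n" "\<Phi> m x \<in> J m \<or> \<Phi> n y \<in> J n"
      using operad_iso_closed[OF iso] by auto
    then have "ocomp Q m n i (\<Phi> m x) (\<Phi> n y) \<in> J (m + n - 1)"
      using J' * by blast
    then show "ocomp P m n i x y \<in> {x \<in> ops P (m + n - 1). \<Phi> (m + n - 1) x \<in> J (m + n - 1)}"
      using * P.comp_closed operad_isoD(5)[OF iso] by auto
  qed auto
qed

lemma operad_iso_inv_into:
  assumes iso: "operad_iso \<Phi> P Q" and P: "ns_operad P"
  shows "operad_iso (\<lambda>n. inv_into (ops P n) (\<Phi> n)) Q P"
proof -
  interpret P: ns_operad P by fact
  let ?\<Psi> = "\<lambda>n. inv_into (ops P n) (\<Phi> n)"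
  have left: "?\<Psi> n (\<Phi> n x) = x" if "x \<in> ops P n" for n x
    using bij_betw_inv_into_left[OF operad_isoD(1)[OF iso] that] .
  have ops: "ops Q n = \<Phi> n ` ops P n" for n
    using operad_isoD(1)[OF iso] by (simp add: bij_betw_def)
  have comp: "?\<Psi> (m + n - 1) (ocomp Q m n i (\<Phi> m x) (\<Phi> n y)) = ocomp P m n i x y"
    if "x \<in> ops P m" "y \<in> ops P n" "1 \<le> i" "i \<le> m" for m n i x y
    using left[OF P.comp_closed[OF that]] operad_isoD(5)[OF iso that] by simp
  show ?thesis
    unfolding operad_iso_def ops
    by (intro conjI allI ballI)
       (use bij_betw_inv_into[OF operad_isoD(1)[OF iso]] comp left[OF P.unit_closed] in
         \<open>auto simp: ops left P.add_closed P.scale_closed simp flip: operad_isoD(2-4)[OF iso]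
           simp del: One_nat_def\<close>)
qed

lemma image_generated_ideal_subset:
  assumes iso: "operad_iso \<Phi> P Q" and P: "ns_operad P" and Q: "ns_operad Q" and R: "R \<subseteq> ops P 3"
  shows "\<Phi> n ` generated_ideal P R n \<subseteq> generated_ideal Q (\<Phi> 3 ` R) n"
proof (intro image_subsetI)
  fix x assume x: "x \<in> generated_ideal P R n"
  show "\<Phi> n x \<in> generated_ideal Q (\<Phi> 3 ` R) n"
    unfolding generated_ideal_def
  proof clarify
    fix J assume J: "operad_ideal Q J" "\<Phi> 3 ` R \<subseteq> J 3"
    have "x \<in> {x \<in> ops P n. \<Phi> n x \<in> J n}"
      using x operad_ideal_vimage[OF iso P Q J(1)] J(2) R unfolding generated_ideal_def by blast
    then show "\<Phi> n x \<in> J n" by simp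
  qed
qed

lemma image_generated_ideal:
  assumes iso: "operad_iso \<Phi> P Q" and P: "ns_operad P" and Q: "ns_operad Q" and R: "R \<subseteq> ops P 3"
  shows "\<Phi> n ` generated_ideal P R n = generated_ideal Q (\<Phi> 3 ` R) n"
proof
  let ?\<Psi> = "\<lambda>n. inv_into (ops P n) (\<Phi> n)"
  have \<Phi>R: "\<Phi> 3 ` R \<subseteq> ops Q 3"
    using R operad_iso_closed[OF iso] by blast
  have "?\<Psi> 3 ` \<Phi> 3 ` R = R"
    using R operad_isoD(1)[OF iso, of 3] by (simp add: bij_betw_def)
  then have "?\<Psi> n ` generated_ideal Q (\<Phi> 3 ` R) n \<subseteq> generated_ideal P R n"
    using image_generated_ideal_subset[OF operad_iso_inv_into[OF iso P] Q P \<Phi>R] by simp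
  moreover have "\<Phi> n (?\<Psi> n y) = y" if "y \<in> generated_ideal Q (\<Phi> 3 ` R) n" for y
    using that generated_ideal_subset[OF Q \<Phi>R] bij_betw_inv_into_right[OF operad_isoD(1)[OF iso]]
    by blast
  ultimately show "generated_ideal Q (\<Phi> 3 ` R) n \<subseteq> \<Phi> n ` generated_ideal P R n"
    by (force simp: image_subset_iff intro: rev_image_eqI)
qed (rule image_generated_ideal_subset[OF assms])

lemma image_operad_coset:
  assumes "operad_iso \<Phi> P Q" "I n \<subseteq> ops P n" "x \<in> ops P n"
  shows "\<Phi> n ` operad_coset P I n x = operad_coset Q (\<lambda>n. \<Phi> n ` I n) n (\<Phi> n x)"
  using assms operad_isoD(2)[OF assms(1)] unfolding operad_coset_def image_image
  by (intro image_cong) auto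

lemma operad_iso_quotient:
  assumes iso: "operad_iso \<Phi> P Q" and P: "ns_operad P" and I: "\<And>n. I n \<subseteq> ops P n"
  shows "operad_iso (\<lambda>n. (`) (\<Phi> n)) (quotient_operad P I) (quotient_operad Q (\<lambda>n. \<Phi> n ` I n))"
proof -
  interpret P: ns_operad P by fact
  let ?J = "\<lambda>n. \<Phi> n ` I n"
  have coset: "\<Phi> n ` operad_coset P I n x = operad_coset Q ?J n (\<Phi> n x)" if "x \<in> ops P n" for n x
    using image_operad_coset[where \<Phi> = \<Phi> and I = I, OF iso I that] .
  have sub: "X \<subseteq> ops P n" if "X \<in> ops (quotient_operad P I) n" for X n
    using that I[of n] by (auto simp: quotient_operad_def operad_coset_def intro!: P.add_closed)
  have inj: "inj_on (\<Phi> n) (ops P n)" and ops: "ops Q n = \<Phi> n ` ops P n" for n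
    using operad_isoD(1)[OF iso, of n] by (simp_all add: bij_betw_def)
  have bij: "bij_betw ((`) (\<Phi> n)) (ops (quotient_operad P I) n) (ops (quotient_operad Q ?J) n)" for n
    unfolding bij_betw_def
  proof
    show "inj_on ((`) (\<Phi> n)) (ops (quotient_operad P I) n)"
      using sub inj_on_image_eq_iff[OF inj] by (auto simp: inj_on_def)
    show "(`) (\<Phi> n) ` ops (quotient_operad P I) n = ops (quotient_operad Q ?J) n"
      unfolding quotient_operad_def by (simp add: ops image_image coset)
  qed
  have add: "\<Phi> n ` oadd (quotient_operad P I) n X Y =
      oadd (quotient_operad Q ?J) n (\<Phi> n ` X) (\<Phi> n ` Y)" if "X \<subseteq> ops P n" "Y \<subseteq> ops P n" for n X Y
    using that unfolding quotient_operad_def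
    by (simp add: image_UN, intro SUP_cong refl)
       (auto simp: coset P.add_closed operad_isoD(2)[OF iso] subset_iff)
  have scale: "\<Phi> n ` oscale (quotient_operad P I) n c X =
      oscale (quotient_operad Q ?J) n c (\<Phi> n ` X)" if "X \<subseteq> ops P n" for n c X
    using that unfolding quotient_operad_def
    by (simp add: image_UN, intro SUP_cong refl)
       (auto simp: coset P.scale_closed operad_isoD(3)[OF iso] subset_iff)
  have comp: "\<Phi> (m + n - 1) ` ocomp (quotient_operad P I) m n i X Y =
      ocomp (quotient_operad Q ?J) m n i (\<Phi> m ` X) (\<Phi> n ` Y)"
    if XY: "X \<subseteq> ops P m" "Y \<subseteq> ops P n" and i: "1 \<le> i" "i \<le> m" for m n i X Y
  proof -
    have "\<Phi> (m + n - 1) ` operad_coset P I (m + n - 1) (ocomp P m n i x y) =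
        operad_coset Q ?J (m + n - 1) (ocomp Q m n i (\<Phi> m x) (\<Phi> n y))" if "x \<in> X" "y \<in> Y" for x y
      using that XY i coset[OF P.comp_closed] operad_isoD(5)[OF iso] by (simp add: subset_iff)
    then show ?thesis
      unfolding quotient_operad_def by (simp add: image_UN)
  qed
  have unit: "\<Phi> 1 ` ounit (quotient_operad P I) = ounit (quotient_operad Q ?J)"
    unfolding quotient_operad_def
    using coset[OF P.unit_closed] operad_isoD(4)[OF iso] by simp
  show ?thesis
    unfolding operad_iso_def
    by (intro conjI allI ballI impI bij add scale comp unit sub) auto
qed


section \<open>Substitution of generators\<close>

lemma free_operad_simps:
  "ozero (free_operad G) n = 0" "oadd (free_operad G) n = (+)" "oscale (free_operad G) n = lscale"
  "ounit (free_operad G) = Poly_Mapping.single \<langle>\<rangle> 1" "ocomp (free_operad G) m n i x y = x \<circ>\<^bsub>i\<^esub> y"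
  by (simp_all add: free_operad_def)

lemmas free_operad_axioms = ns_operad_free_operad[THEN ns_operad.comp_sequential]
  ns_operad_free_operad[THEN ns_operad.comp_parallel]
  ns_operad_free_operad[THEN ns_operad.comp_unit_left]
  ns_operad_free_operad[THEN ns_operad.comp_unit_right]

lemmas tree_comp_sequential = free_operad_axioms(1)[unfolded free_operad_simps]
  and tree_comp_parallel = free_operad_axioms(2)[unfolded free_operad_simps]
  and tree_comp_unit_left = free_operad_axioms(3)[unfolded free_operad_simps]
  and tree_comp_unit_right = free_operad_axioms(4)[unfolded free_operad_simps]

lemma tree_comp_sum_right: "x \<circ>\<^bsub>i\<^esub> sum f A = (\<Sum>a\<in>A. x \<circ>\<^bsub>i\<^esub> f a)"
  by (induction A rule: infinite_finite_induct) (simp_all add: tree_comp_add_right)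

lemma subspace_free_operad: "lincomb.subspace (ops (free_operad G) n)"
proof (rule lincomb.subspaceI)
  show "lscale c x \<in> ops (free_operad G) n" if "x \<in> ops (free_operad G) n" for c x
    using that keys_lscale[of c x] by (auto simp: free_operad_def)
qed (auto simp: free_operad_def dest: keys_add[THEN subsetD])

lemma corolla_closed: "g \<in> G \<Longrightarrow> corolla g \<in> ops (free_operad G) 2"
  by (simp add: free_operad_def corolla_def)

fun tree_subst :: "('g \<Rightarrow> ('h tree \<Rightarrow>\<^sub>0 'k::field)) \<Rightarrow> 'g tree \<Rightarrow> ('h tree \<Rightarrow>\<^sub>0 'k)" where
  "tree_subst f \<langle>\<rangle> = Poly_Mapping.single \<langle>\<rangle> 1"
| "tree_subst f \<langle>l, g, r\<rangle> = (f g \<circ>\<^bsub>2\<^esub> tree_subst f r) \<circ>\<^bsub>1\<^esub> tree_subst f l"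

definition op_subst ::
  "('g \<Rightarrow> ('h tree \<Rightarrow>\<^sub>0 'k::field)) \<Rightarrow> ('g tree \<Rightarrow>\<^sub>0 'k) \<Rightarrow> ('h tree \<Rightarrow>\<^sub>0 'k)" where
  "op_subst f x = (\<Sum>t\<in>Poly_Mapping.keys x. lscale (Poly_Mapping.lookup x t) (tree_subst f t))"

lemma op_subst_superset:
  assumes "finite A" "Poly_Mapping.keys x \<subseteq> A"
  shows "op_subst f x = (\<Sum>t\<in>A. lscale (Poly_Mapping.lookup x t) (tree_subst f t))"
  unfolding op_subst_def by (intro sum.mono_neutral_left assms) (auto simp: in_keys_iff)

lemma op_subst_add: "op_subst f (x + y) = op_subst f x + op_subst f y"
  using keys_add[of x y]
  by (simp add: op_subst_superset[of "Poly_Mapping.keys x \<union> Poly_Mapping.keys y"] lookup_add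
      lincomb.scale_left_distrib sum.distrib)

lemma op_subst_lscale: "op_subst f (lscale c x) = lscale c (op_subst f x)"
  using keys_lscale[of c x]
  by (simp add: op_subst_superset[of "Poly_Mapping.keys x"] lincomb.scale_sum_right)

lemma linear_op_subst: "Vector_Spaces.linear lscale lscale (op_subst f)"
  by unfold_locales (simp_all add: op_subst_add op_subst_lscale)

interpretation op_subst: Vector_Spaces.linear lscale lscale "op_subst f" for f
  by (rule linear_op_subst)

lemma op_subst_single: "op_subst f (Poly_Mapping.single t a) = lscale a (tree_subst f t)"
  by (simp add: op_subst_superset[of "{t}"])

context
  fixes f :: "'g \<Rightarrow> ('h tree \<Rightarrow>\<^sub>0 'k::field)" and G :: "'g set" and H :: "'h set"
  assumes f: "\<And>g. g \<in> G \<Longrightarrow> f g \<in> ops (free_operad H) 2"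
begin

lemma tree_subst_closed: "set_tree t \<subseteq> G \<Longrightarrow> tree_subst f t \<in> ops (free_operad H) (size1 t)"
proof (induction t)
  case (Node l g r)
  then have "f g \<circ>\<^bsub>2\<^esub> tree_subst f r \<in> ops (free_operad H) (2 + size1 r - 1)"
    by (intro tree_comp_closed f) auto
  then have "tree_subst f \<langle>l, g, r\<rangle> \<in> ops (free_operad H) (2 + size1 r - 1 + size1 l - 1)"
    using Node unfolding tree_subst.simps by (intro tree_comp_closed[of "f g \<circ>\<^bsub>2\<^esub> _"]) auto
  moreover have "2 + size1 r - 1 + size1 l - 1 = size1 \<langle>l, g, r\<rangle>" by simp
  ultimately show ?case by (simp only:)
qed (simp add: free_operad_def)

lemma op_subst_closed:
  assumes "x \<in> ops (free_operad G) n"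
  shows "op_subst f x \<in> ops (free_operad H) n"
  unfolding op_subst_def
proof (intro lincomb.subspace_sum lincomb.subspace_scale subspace_free_operad)
  fix t assume "t \<in> Poly_Mapping.keys x"
  then show "tree_subst f t \<in> ops (free_operad H) n"
    using assms tree_subst_closed[of t] by (auto simp: free_operad_def)
qed

lemma op_subst_corolla:
  assumes "g \<in> G"
  shows "op_subst f (corolla g) = f g"
proof -
  have "f g \<circ>\<^bsub>2\<^esub> Poly_Mapping.single \<langle>\<rangle> 1 = f g" "f g \<circ>\<^bsub>1\<^esub> Poly_Mapping.single \<langle>\<rangle> 1 = f g"
    using tree_comp_unit_right[OF f[OF assms]] by simp_all
  then show ?thesis
    by (simp add: corolla_def op_subst_single)
qed

lemma tree_subst_graft:
  assumes "set_tree t \<subseteq> G" "set_tree s \<subseteq> G" "1 \<le> i" "i \<le> size1 t"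
  shows "tree_subst f (graft t i s) = tree_subst f t \<circ>\<^bsub>i\<^esub> tree_subst f s"
  using assms
proof (induction t arbitrary: i)
  case Leaf
  then show ?case using tree_comp_unit_left[OF tree_subst_closed[of s]] by simp
next
  case (Node l g r)
  let ?E = "tree_subst f"
  have E: "?E l \<in> ops (free_operad H) (size1 l)" "?E r \<in> ops (free_operad H) (size1 r)"
    "?E s \<in> ops (free_operad H) (size1 s)" and g: "f g \<in> ops (free_operad H) 2"
    using Node.prems by (auto intro!: tree_subst_closed f)
  have X: "f g \<circ>\<^bsub>2\<^esub> ?E r \<in> ops (free_operad H) (2 + size1 r - 1)"
    using tree_comp_closed[OF g E(2), of 2] by simp
  show ?case
  proof (cases "i \<le> size1 l")
    case True
    then show ?thesis
      using Node.IH(1)[of i] Node.prems tree_comp_sequential[OF X E(1,3), of 1 i] by simp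
  next
    case False
    define j where "j = i - size1 l"
    have j: "1 \<le> j" "j \<le> size1 r" "i = j + size1 l"
      using False Node.prems by (auto simp: j_def)
    have "?E (graft \<langle>l, g, r\<rangle> i s) = (f g \<circ>\<^bsub>2\<^esub> (?E r \<circ>\<^bsub>j\<^esub> ?E s)) \<circ>\<^bsub>1\<^esub> ?E l"
      using Node.IH(2)[of j] Node.prems j by simp
    also have "f g \<circ>\<^bsub>2\<^esub> (?E r \<circ>\<^bsub>j\<^esub> ?E s) = (f g \<circ>\<^bsub>2\<^esub> ?E r) \<circ>\<^bsub>j + 1\<^esub> ?E s"
    proof -
      have "2 + j - 1 = j + 1" by simp
      then show ?thesis using tree_comp_sequential[OF g E(2,3), of 2 j] j by simp
    qed
    also have "((f g \<circ>\<^bsub>2\<^esub> ?E r) \<circ>\<^bsub>j + 1\<^esub> ?E s) \<circ>\<^bsub>1\<^esub> ?E l = ?E \<langle>l, g, r\<rangle> \<circ>\<^bsub>i\<^esub> ?E s"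
      using tree_comp_parallel[OF X E(1,3), of 1 "j + 1"] j by simp
    finally show ?thesis .
  qed
qed

lemma op_subst_comp:
  assumes x: "x \<in> ops (free_operad G) m" and y: "y \<in> ops (free_operad G) n"
    and i: "1 \<le> i" "i \<le> m"
  shows "op_subst f (x \<circ>\<^bsub>i\<^esub> y) = op_subst f x \<circ>\<^bsub>i\<^esub> op_subst f y"
  using x
proof (induction rule: free_operad_induct)
  case (single t a)
  note t = single
  from y show ?case
  proof (induction rule: free_operad_induct)
    case (single s b)
    then show ?case
      using t i
      by (simp add: tree_comp_single op_subst_single tree_subst_graft tree_comp_lscale_left
          tree_comp_lscale_right)
  qed (simp_all add: tree_comp_add_right op_subst_add)
qed (simp_all add: tree_comp_add_left op_subst_add)

end

lemma op_subst_inverse: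
  fixes f :: "'g \<Rightarrow> ('h tree \<Rightarrow>\<^sub>0 'k::field)"
  assumes f: "\<And>g. g \<in> G \<Longrightarrow> f g \<in> ops (free_operad H) 2"
    and f': "\<And>h. h \<in> H \<Longrightarrow> f' h \<in> ops (free_operad G) 2"
    and inverse: "\<And>g. g \<in> G \<Longrightarrow> op_subst f' (f g) = corolla g"
    and x: "x \<in> ops (free_operad G) n"
  shows "op_subst f' (op_subst f x) = x"
proof -
  have tree: "op_subst f' (tree_subst f t) = Poly_Mapping.single t 1" if "set_tree t \<subseteq> G" for t
    using that
  proof (induction t)
    case (Node l g r)
    then have gG: "g \<in> G" by simp
    have cl: "tree_subst f l \<in> ops (free_operad H) (size1 l)"
      "tree_subst f r \<in> ops (free_operad H) (size1 r)"
      using Node.prems by (auto intro!: tree_subst_closed[where G = G] f)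
    have X: "f g \<circ>\<^bsub>2\<^esub> tree_subst f r \<in> ops (free_operad H) (2 + size1 r - 1)"
      using tree_comp_closed[OF f[OF gG] cl(2), of 2] by simp
    have "op_subst f' (tree_subst f \<langle>l, g, r\<rangle>) =
        (op_subst f' (f g) \<circ>\<^bsub>2\<^esub> op_subst f' (tree_subst f r)) \<circ>\<^bsub>1\<^esub> op_subst f' (tree_subst f l)"
      using op_subst_comp[of H f', OF f' X cl(1), of 1]
        op_subst_comp[of H f', OF f' f[OF gG] cl(2), of 2] by simp
    also have "\<dots> = Poly_Mapping.single \<langle>l, g, r\<rangle> 1"
      using Node gG by (simp add: inverse corolla_def tree_comp_single)
    finally show ?case .
  qed (simp add: op_subst_single)
  from x show ?thesis
    by (induction rule: free_operad_induct)
       (simp_all add: op_subst_add op_subst_single op_subst_lscale tree lscale_single)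
qed

lemma operad_iso_op_subst:
  fixes f :: "'g \<Rightarrow> ('h tree \<Rightarrow>\<^sub>0 'k::field)"
  assumes f: "\<And>g. g \<in> G \<Longrightarrow> f g \<in> ops (free_operad H) 2"
    and f': "\<And>h. h \<in> H \<Longrightarrow> f' h \<in> ops (free_operad G) 2"
    and inverse: "\<And>g. g \<in> G \<Longrightarrow> op_subst f' (f g) = corolla g"
    and inverse': "\<And>h. h \<in> H \<Longrightarrow> op_subst f (f' h) = corolla h"
  shows "operad_iso (\<lambda>_. op_subst f) (free_operad G) (free_operad H)"
proof -
  have "bij_betw (op_subst f) (ops (free_operad G) n) (ops (free_operad H) n)" for n
  proof (rule bij_betw_byWitness[where f' = "op_subst f'"])
    show "\<forall>x\<in>ops (free_operad G) n. op_subst f' (op_subst f x) = x"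
      using op_subst_inverse[OF f f' inverse] by blast
    show "\<forall>y\<in>ops (free_operad H) n. op_subst f (op_subst f' y) = y"
      using op_subst_inverse[OF f' f inverse'] by blast
    show "op_subst f ` ops (free_operad G) n \<subseteq> ops (free_operad H) n"
      using op_subst_closed[of G f H, OF f] by (rule image_subsetI)
    show "op_subst f' ` ops (free_operad H) n \<subseteq> ops (free_operad G) n"
      using op_subst_closed[of H f' G, OF f'] by (rule image_subsetI)
  qed
  moreover have "op_subst f (x \<circ>\<^bsub>i\<^esub> y) = op_subst f x \<circ>\<^bsub>i\<^esub> op_subst f y"
    if "x \<in> ops (free_operad G) m" "y \<in> ops (free_operad G) n" "1 \<le> i" "i \<le> m" for x y m n i
    using op_subst_comp[of G f H, OF f that] .
  ultimately show ?thesis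
    unfolding operad_iso_def free_operad_simps
    by (simp add: op_subst_add op_subst_lscale op_subst_single)
qed


section \<open>The two relation spaces\<close>

lemma (in vector_space) span_second_differences:
  fixes F :: "nat \<Rightarrow> nat \<Rightarrow> 'b"
  assumes zero: "\<And>a. F a 0 = 0" "\<And>b. F 0 b = 0"
    and diff: "\<And>a b. f (Suc a) (Suc b) = F (Suc a) (Suc b) - F a (Suc b) - F (Suc a) b + F a b"
  shows "span {F a b |a b. a \<in> {1..\<gamma>} \<and> b \<in> {1..\<gamma>}} =
    span {f a b |a b. a \<in> {1..\<gamma>} \<and> b \<in> {1..\<gamma>}}"
    (is "span ?F = span ?f")
proof (rule span_eq[THEN iffD2], intro conjI subsetI)
  have F: "F a b \<in> span ?f" if "a \<le> \<gamma>" "b \<le> \<gamma>" for a b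
    using that
  proof (induction a arbitrary: b)
    case (Suc a)
    note IH = Suc.IH
    from \<open>b \<le> \<gamma>\<close> show ?case
    proof (induction b)
      case (Suc b)
      have "f (Suc a) (Suc b) \<in> span ?f"
        using Suc.prems \<open>Suc a \<le> \<gamma>\<close> by (intro span_base) fastforce
      moreover have "F (Suc a) (Suc b) = f (Suc a) (Suc b) + F a (Suc b) + F (Suc a) b - F a b"
        by (simp add: diff)
      ultimately show ?case
        using IH[of b] IH[of "Suc b"] Suc \<open>Suc a \<le> \<gamma>\<close> by (auto intro!: span_add span_diff)
    qed (simp add: zero span_zero)
  qed (simp add: zero span_zero)
  then show "x \<in> span ?f" if "x \<in> ?F" for x
    using that by auto
  have F': "F a b \<in> span ?F" if "a \<le> \<gamma>" "b \<le> \<gamma>" for a b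
  proof (cases "a = 0 \<or> b = 0")
    case False
    then have "a \<in> {1..\<gamma>} \<and> b \<in> {1..\<gamma>}" using that by auto
    then show ?thesis by (intro span_base) blast
  qed (auto simp: zero span_zero)
  show "x \<in> span ?F" if "x \<in> ?f" for x
  proof -
    obtain a b where x: "x = f a b" and ab: "a \<in> {1..\<gamma>}" "b \<in> {1..\<gamma>}"
      using \<open>x \<in> ?f\<close> by blast
    then obtain a' b' where "a = Suc a'" "b = Suc b'"
      by (metis atLeastAtMost_iff not_one_le_zero old.nat.exhaust)
    with ab have "a' \<le> \<gamma>" "Suc a' \<le> \<gamma>" "b' \<le> \<gamma>" "Suc b' \<le> \<gamma>" by simp_all
    then show ?thesis
      unfolding x \<open>a = Suc a'\<close> \<open>b = Suc b'\<close> diff by (intro span_add span_diff F')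
  qed
qed

lemma (in vector_space) span_Un_cong:
  "\<lbrakk>span A = span A'; span B = span B'\<rbrakk> \<Longrightarrow> span (A \<union> B) = span (A' \<union> B')"
  by (simp add: span_Un)

lemma square_partition:
  fixes \<gamma> :: nat
  shows "{F a b |a b. a \<in> {1..\<gamma>} \<and> b \<in> {1..\<gamma>}} =
    {F a b |a b. a \<in> {1..\<gamma>} \<and> b \<in> {1..\<gamma>} \<and> a < b} \<union>
    {F b a |a b. a \<in> {1..\<gamma>} \<and> b \<in> {1..\<gamma>} \<and> a < b} \<union> {F a a |a. a \<in> {1..\<gamma>}}"
  by (auto, metis linorder_neqE_nat)

definition mixed_rel ::
  "(nat \<Rightarrow> ('g tree \<Rightarrow>\<^sub>0 'k::field)) \<Rightarrow> (nat \<Rightarrow> ('g tree \<Rightarrow>\<^sub>0 'k)) \<Rightarrow> nat \<Rightarrow> nat \<Rightarrow> ('g tree \<Rightarrow>\<^sub>0 'k)"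
where
  "mixed_rel p s a b = p a \<circ>\<^bsub>1\<^esub> s b - s b \<circ>\<^bsub>2\<^esub> p a"

definition prec_rel ::
  "(nat \<Rightarrow> ('g tree \<Rightarrow>\<^sub>0 'k::field)) \<Rightarrow> (nat \<Rightarrow> ('g tree \<Rightarrow>\<^sub>0 'k)) \<Rightarrow> nat \<Rightarrow> nat \<Rightarrow> ('g tree \<Rightarrow>\<^sub>0 'k)"
where
  "prec_rel p s a b = p a \<circ>\<^bsub>1\<^esub> p b - p (min a b) \<circ>\<^bsub>2\<^esub> (p a + s b)"

definition succ_rel ::
  "(nat \<Rightarrow> ('g tree \<Rightarrow>\<^sub>0 'k::field)) \<Rightarrow> (nat \<Rightarrow> ('g tree \<Rightarrow>\<^sub>0 'k)) \<Rightarrow> nat \<Rightarrow> nat \<Rightarrow> ('g tree \<Rightarrow>\<^sub>0 'k)"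
where
  "succ_rel p s a b = s (min a b) \<circ>\<^bsub>1\<^esub> (s a + p b) - s a \<circ>\<^bsub>2\<^esub> s b"

lemma dendr_relations'_eq:
  "dendr_relations' \<gamma> p s = lincomb.span (
     {mixed_rel p s a b |a b. a \<in> {1..\<gamma>} \<and> b \<in> {1..\<gamma>}} \<union>
     {prec_rel p s a b |a b. a \<in> {1..\<gamma>} \<and> b \<in> {1..\<gamma>}} \<union>
     {succ_rel p s a b |a b. a \<in> {1..\<gamma>} \<and> b \<in> {1..\<gamma>}})"
proof -
  have prec:
    "{p a \<circ>\<^bsub>1\<^esub> p b - p a \<circ>\<^bsub>2\<^esub> s b - p a \<circ>\<^bsub>2\<^esub> p a |a b. a \<in> {1..\<gamma>} \<and> b \<in> {1..\<gamma>} \<and> a < b} =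
     {prec_rel p s a b |a b. a \<in> {1..\<gamma>} \<and> b \<in> {1..\<gamma>} \<and> a < b}"
    "{p b \<circ>\<^bsub>1\<^esub> p a - p a \<circ>\<^bsub>2\<^esub> p b - p a \<circ>\<^bsub>2\<^esub> s a |a b. a \<in> {1..\<gamma>} \<and> b \<in> {1..\<gamma>} \<and> a < b} =
     {prec_rel p s b a |a b. a \<in> {1..\<gamma>} \<and> b \<in> {1..\<gamma>} \<and> a < b}"
    "{p a \<circ>\<^bsub>1\<^esub> p a - p a \<circ>\<^bsub>2\<^esub> s a - p a \<circ>\<^bsub>2\<^esub> p a |a. a \<in> {1..\<gamma>}} =
     {prec_rel p s a a |a. a \<in> {1..\<gamma>}}"
    by (intro Collect_cong ex_cong1; auto simp: prec_rel_def tree_comp_add_right algebra_simps)+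
  have succ:
    "{s a \<circ>\<^bsub>1\<^esub> s a + s a \<circ>\<^bsub>1\<^esub> p b - s a \<circ>\<^bsub>2\<^esub> s b |a b. a \<in> {1..\<gamma>} \<and> b \<in> {1..\<gamma>} \<and> a < b} =
     {succ_rel p s a b |a b. a \<in> {1..\<gamma>} \<and> b \<in> {1..\<gamma>} \<and> a < b}"
    "{s a \<circ>\<^bsub>1\<^esub> p a + s a \<circ>\<^bsub>1\<^esub> s b - s b \<circ>\<^bsub>2\<^esub> s a |a b. a \<in> {1..\<gamma>} \<and> b \<in> {1..\<gamma>} \<and> a < b} =
     {succ_rel p s b a |a b. a \<in> {1..\<gamma>} \<and> b \<in> {1..\<gamma>} \<and> a < b}"
    "{s a \<circ>\<^bsub>1\<^esub> s a + s a \<circ>\<^bsub>1\<^esub> p a - s a \<circ>\<^bsub>2\<^esub> s a |a. a \<in> {1..\<gamma>}} =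
     {succ_rel p s a a |a. a \<in> {1..\<gamma>}}"
    by (intro Collect_cong ex_cong1; auto simp: succ_rel_def tree_comp_add_right algebra_simps)+
  show ?thesis
    unfolding dendr_relations'_def prec succ square_partition[of "prec_rel p s"]
      square_partition[of "succ_rel p s"] mixed_rel_def
    by (rule arg_cong[of _ _ lincomb.span]) (simp only: Un_ac)
qed

lemma prec_0 [simp]: "prec 0 = 0" and succ_0 [simp]: "succ 0 = 0"
  by (simp_all add: prec_def succ_def)

lemma prec_Suc: "prec (Suc a) = prec a + lh (Suc a)" and succ_Suc: "succ (Suc a) = succ a + rh (Suc a)"
  by (simp_all add: prec_def succ_def)

definition lh_rel :: "nat \<Rightarrow> nat \<Rightarrow> (dendr_gen tree \<Rightarrow>\<^sub>0 'k::field)" where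
  "lh_rel a b = lh a \<circ>\<^bsub>1\<^esub> lh b -
     (if a < b then lh a \<circ>\<^bsub>2\<^esub> rh b else if b < a then lh b \<circ>\<^bsub>2\<^esub> lh a else lh a \<circ>\<^bsub>2\<^esub> (prec a + succ a))"

definition rh_rel :: "nat \<Rightarrow> nat \<Rightarrow> (dendr_gen tree \<Rightarrow>\<^sub>0 'k::field)" where
  "rh_rel a b =
     (if a < b then rh a \<circ>\<^bsub>1\<^esub> lh b else if b < a then rh b \<circ>\<^bsub>1\<^esub> rh a else rh a \<circ>\<^bsub>1\<^esub> (succ a + prec a)) -
     rh a \<circ>\<^bsub>2\<^esub> rh b"

lemma dendr_relations_eq:
  "dendr_relations \<gamma> = lincomb.span (
     {mixed_rel lh rh a b |a b. a \<in> {1..\<gamma>} \<and> b \<in> {1..\<gamma>}} \<union>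
     {lh_rel a b |a b. a \<in> {1..\<gamma>} \<and> b \<in> {1..\<gamma>}} \<union>
     {rh_rel a b |a b. a \<in> {1..\<gamma>} \<and> b \<in> {1..\<gamma>}})"
proof -
  have lh:
    "{lh a \<circ>\<^bsub>1\<^esub> lh b - lh a \<circ>\<^bsub>2\<^esub> rh b |a b. a \<in> {1..\<gamma>} \<and> b \<in> {1..\<gamma>} \<and> a < b} =
     {lh_rel a b |a b. a \<in> {1..\<gamma>} \<and> b \<in> {1..\<gamma>} \<and> a < b}"
    "{lh b \<circ>\<^bsub>1\<^esub> lh a - lh a \<circ>\<^bsub>2\<^esub> lh b |a b. a \<in> {1..\<gamma>} \<and> b \<in> {1..\<gamma>} \<and> a < b} =
     {lh_rel b a |a b. a \<in> {1..\<gamma>} \<and> b \<in> {1..\<gamma>} \<and> a < b}"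
    "{lh d \<circ>\<^bsub>1\<^esub> lh d - (\<Sum>c\<in>{1..d}. lh d \<circ>\<^bsub>2\<^esub> lh c + lh d \<circ>\<^bsub>2\<^esub> rh c) |d. d \<in> {1..\<gamma>}} =
     {lh_rel a a |a. a \<in> {1..\<gamma>}}"
    by (intro Collect_cong ex_cong1;
        auto simp: lh_rel_def tree_comp_add_right prec_def succ_def tree_comp_sum_right sum.distrib)+
  have rh:
    "{rh a \<circ>\<^bsub>1\<^esub> lh b - rh a \<circ>\<^bsub>2\<^esub> rh b |a b. a \<in> {1..\<gamma>} \<and> b \<in> {1..\<gamma>} \<and> a < b} =
     {rh_rel a b |a b. a \<in> {1..\<gamma>} \<and> b \<in> {1..\<gamma>} \<and> a < b}"
    "{rh a \<circ>\<^bsub>1\<^esub> rh b - rh b \<circ>\<^bsub>2\<^esub> rh a |a b. a \<in> {1..\<gamma>} \<and> b \<in> {1..\<gamma>} \<and> a < b} =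
     {rh_rel b a |a b. a \<in> {1..\<gamma>} \<and> b \<in> {1..\<gamma>} \<and> a < b}"
    "{(\<Sum>c\<in>{1..d}. rh d \<circ>\<^bsub>1\<^esub> rh c + rh d \<circ>\<^bsub>1\<^esub> lh c) - rh d \<circ>\<^bsub>2\<^esub> rh d |d. d \<in> {1..\<gamma>}} =
     {rh_rel a a |a. a \<in> {1..\<gamma>}}"
    by (intro Collect_cong ex_cong1;
        auto simp: rh_rel_def tree_comp_add_right prec_def succ_def tree_comp_sum_right sum.distrib)+
  show ?thesis
    unfolding dendr_relations_def lh rh square_partition[of lh_rel] square_partition[of rh_rel]
      mixed_rel_def
    by (rule arg_cong[of _ _ lincomb.span]) (simp only: Un_ac)
qed

lemma dendr_relations'_prec_succ: "dendr_relations' \<gamma> prec succ = dendr_relations \<gamma>"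
  unfolding dendr_relations'_eq dendr_relations_eq
proof (intro lincomb.span_Un_cong lincomb.span_second_differences)
  note simps = prec_Suc succ_Suc tree_comp_add_left tree_comp_add_right algebra_simps
  fix a b :: nat
  show "mixed_rel lh rh (Suc a) (Suc b) = mixed_rel prec succ (Suc a) (Suc b) -
      mixed_rel prec succ a (Suc b) - mixed_rel prec succ (Suc a) b + mixed_rel prec succ a b"
    by (simp add: mixed_rel_def simps)
  consider (less) "a < b" | (eq) "a = b" | (greater) "b < a" by linarith
  note cases = this
  show "lh_rel (Suc a) (Suc b) = prec_rel prec succ (Suc a) (Suc b) -
      prec_rel prec succ a (Suc b) - prec_rel prec succ (Suc a) b + prec_rel prec succ a b"
    by (cases rule: cases) (simp_all add: lh_rel_def prec_rel_def min_absorb1 min_absorb2 simps)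
  show "rh_rel (Suc a) (Suc b) = succ_rel prec succ (Suc a) (Suc b) -
      succ_rel prec succ a (Suc b) - succ_rel prec succ (Suc a) b + succ_rel prec succ a b"
    by (cases rule: cases) (simp_all add: rh_rel_def succ_rel_def min_absorb1 min_absorb2 simps)
qed (simp_all add: mixed_rel_def prec_rel_def succ_rel_def)

lemma dendr_relations'_closed:
  assumes "\<And>b. b \<in> {1..\<gamma>} \<Longrightarrow> p b \<in> ops (free_operad G) 2"
    and "\<And>b. b \<in> {1..\<gamma>} \<Longrightarrow> s b \<in> ops (free_operad G) 2"
  shows "dendr_relations' \<gamma> p s \<subseteq> ops (free_operad G) 3"
proof -
  have comp: "x \<circ>\<^bsub>i\<^esub> y \<in> ops (free_operad G) 3"
    if "x \<in> ops (free_operad G) 2" "y \<in> ops (free_operad G) 2" "i = 1 \<or> i = 2" for x y i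
    using tree_comp_closed[OF that(1,2), of i] that(3) by auto
  have "min a b \<in> {1..\<gamma>}" if "a \<in> {1..\<gamma>}" "b \<in> {1..\<gamma>}" for a b
    using that by (simp add: min_def)
  note closed = assms this comp
  show ?thesis
    unfolding dendr_relations'_eq
    by (rule lincomb.span_minimal[OF _ subspace_free_operad])
       (auto simp: mixed_rel_def prec_rel_def succ_rel_def simp del: One_nat_def atLeastAtMost_iff
         intro!: lincomb.subspace_diff[OF subspace_free_operad] free_operad_add_closed closed)
qed

lemma op_subst_dendr_relations':
  assumes f: "\<And>g. g \<in> G \<Longrightarrow> f g \<in> ops (free_operad H) 2"
    and p: "\<And>b. b \<in> {1..\<gamma>} \<Longrightarrow> p b \<in> ops (free_operad G) 2 \<and> op_subst f (p b) = p' b"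
    and s: "\<And>b. b \<in> {1..\<gamma>} \<Longrightarrow> s b \<in> ops (free_operad G) 2 \<and> op_subst f (s b) = s' b"
  shows "op_subst f ` dendr_relations' \<gamma> p s = dendr_relations' \<gamma> p' s'"
proof -
  have comp: "op_subst f (x \<circ>\<^bsub>i\<^esub> y) = op_subst f x \<circ>\<^bsub>i\<^esub> op_subst f y"
    if "x \<in> ops (free_operad G) 2" "y \<in> ops (free_operad G) 2" "i = 1 \<or> i = 2" for x y i
    using op_subst_comp[of G f H, OF f that(1,2), of i] that(3) by auto
  have image: "op_subst f ` {F a b |a b. a \<in> {1..\<gamma>} \<and> b \<in> {1..\<gamma>}} =
      {F' a b |a b. a \<in> {1..\<gamma>} \<and> b \<in> {1..\<gamma>}}"
    if "\<And>a b. \<lbrakk>a \<in> {1..\<gamma>}; b \<in> {1..\<gamma>}\<rbrakk> \<Longrightarrow> op_subst f (F a b) = F' a b" for F F'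
  proof -
    have "op_subst f ` {F a b |a b. a \<in> {1..\<gamma>} \<and> b \<in> {1..\<gamma>}} =
        {op_subst f (F a b) |a b. a \<in> {1..\<gamma>} \<and> b \<in> {1..\<gamma>}}" by blast
    also have "\<dots> = {F' a b |a b. a \<in> {1..\<gamma>} \<and> b \<in> {1..\<gamma>}}"
      by (intro Collect_cong ex_cong1) (auto simp: that)
    finally show ?thesis .
  qed
  have m: "min a b \<in> {1..\<gamma>}" if "a \<in> {1..\<gamma>}" "b \<in> {1..\<gamma>}" for a b
    using that by (simp add: min_def)
  note simps = comp p s m op_subst_add op_subst.diff free_operad_add_closed
  have rels:
    "op_subst f (mixed_rel p s a b) = mixed_rel p' s' a b"
    "op_subst f (prec_rel p s a b) = prec_rel p' s' a b"
    "op_subst f (succ_rel p s a b) = succ_rel p' s' a b" if "a \<in> {1..\<gamma>}" "b \<in> {1..\<gamma>}" for a b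
    using that
    by (simp_all add: mixed_rel_def prec_rel_def succ_rel_def simps
        del: One_nat_def atLeastAtMost_iff)
  show ?thesis
    unfolding dendr_relations'_eq op_subst.span_image[symmetric] image_Un
    by (simp only: image[of "mixed_rel p s", OF rels(1)] image[of "prec_rel p s", OF rels(2)]
        image[of "succ_rel p s", OF rels(3)])
qed


section \<open>The change of generators\<close>

lemma dendr_gens_cases:
  assumes "g \<in> dendr_gens \<gamma>"
  obtains a where "Suc a \<in> {1..\<gamma>}" "g = LHarp (Suc a)" | a where "Suc a \<in> {1..\<gamma>}" "g = RHarp (Suc a)"
proof -
  obtain b where "b \<in> {1..\<gamma>}" "g = LHarp b \<or> g = RHarp b"
    using assms by (auto simp: dendr_gens_def)
  then show thesis using that by (cases b) auto
qed

lemma dendr_gens'_closed: "g \<in> dendr_gens' \<gamma> \<Longrightarrow> g \<in> ops (free_operad (dendr_gens \<gamma>)) 2"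
  by (auto simp: dendr_gens'_def prec_def succ_def dendr_gens_def
      intro!: lincomb.subspace_sum[OF subspace_free_operad] corolla_closed)

lemma span_dendr_gens':
  "lincomb.span (dendr_gens' \<gamma> :: (dendr_gen tree \<Rightarrow>\<^sub>0 'k::field) set) =
    ops (free_operad (dendr_gens \<gamma>)) 2"
proof
  let ?S = "lincomb.span (dendr_gens' \<gamma> :: (dendr_gen tree \<Rightarrow>\<^sub>0 'k) set)"
  show "?S \<subseteq> ops (free_operad (dendr_gens \<gamma>)) 2"
    using dendr_gens'_closed by (intro lincomb.span_minimal subspace_free_operad) auto
  have base: "prec a \<in> ?S" "succ a \<in> ?S"
    if "a \<le> \<gamma>" for a
    using that by (cases "a = 0"; auto simp: dendr_gens'_def lincomb.span_zero intro!: lincomb.span_base)+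
  have gen: "corolla g \<in> ?S" if "g \<in> dendr_gens \<gamma>" for g
    using that
  proof (cases rule: dendr_gens_cases)
    case (1 a)
    then have "prec (Suc a) - prec a \<in> ?S" by (intro lincomb.span_diff base) auto
    then show ?thesis by (simp add: 1 prec_Suc)
  next
    case (2 a)
    then have "succ (Suc a) - succ a \<in> ?S" by (intro lincomb.span_diff base) auto
    then show ?thesis by (simp add: 2 succ_Suc)
  qed
  show "ops (free_operad (dendr_gens \<gamma>)) 2 \<subseteq> ?S"
  proof
    fix x :: "dendr_gen tree \<Rightarrow>\<^sub>0 'k" assume "x \<in> ops (free_operad (dendr_gens \<gamma>)) 2"
    then show "x \<in> ?S"
    proof (induction rule: free_operad_induct)
      case (single t a)
      obtain g where t: "t = \<langle>\<langle>\<rangle>, g, \<langle>\<rangle>\<rangle>"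
      proof (cases t)
        case (Node l g r)
        then have "size l + size r = 0" using single(1) by (simp add: size1_size)
        then show thesis using Node that by simp
      qed (use single in simp)
      have "Poly_Mapping.single t a = lscale a (corolla g)"
        by (simp add: t corolla_def lscale_single)
      moreover have "corolla g \<in> ?S" using single(2) t by (intro gen) simp
      ultimately show ?case using lincomb.span_scale by metis
    qed (auto intro: lincomb.span_zero lincomb.span_add)
  qed
qed

fun dendr_gen_diff :: "dendr_gen \<Rightarrow> ((dendr_gen tree \<Rightarrow>\<^sub>0 'k::field) tree \<Rightarrow>\<^sub>0 'k)" where
  "dendr_gen_diff (LHarp a) = corolla (prec a) - (if a = 1 then 0 else corolla (prec (a - 1)))"
| "dendr_gen_diff (RHarp a) = corolla (succ a) - (if a = 1 then 0 else corolla (succ (a - 1)))"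

lemma dendr_gen_diff_closed:
  assumes "g \<in> dendr_gens \<gamma>"
  shows "dendr_gen_diff g \<in> ops (free_operad (dendr_gens' \<gamma>)) 2"
  using assms
  by (cases rule: dendr_gens_cases)
     (auto simp: dendr_gens'_def intro!: lincomb.subspace_diff[OF subspace_free_operad]
        lincomb.subspace_0[OF subspace_free_operad] corolla_closed)

lemma op_subst_dendr_gen_diff:
  assumes "g \<in> dendr_gens' \<gamma>"
  shows "op_subst dendr_gen_diff g = corolla g"
proof -
  have gen: "op_subst dendr_gen_diff (corolla h) = dendr_gen_diff h" if "h \<in> dendr_gens \<gamma>" for h
    using op_subst_corolla[OF dendr_gen_diff_closed that] .
  have prec: "op_subst dendr_gen_diff (prec (Suc b)) = corolla (prec (Suc b))" if "Suc b \<le> \<gamma>" for b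
    using that
    by (induction b) (simp_all add: prec_Suc[of "Suc _"] prec_Suc[of 0] op_subst_add gen dendr_gens_def)
  have succ: "op_subst dendr_gen_diff (succ (Suc b)) = corolla (succ (Suc b))" if "Suc b \<le> \<gamma>" for b
    using that
    by (induction b) (simp_all add: succ_Suc[of "Suc _"] succ_Suc[of 0] op_subst_add gen dendr_gens_def)
  obtain b where "Suc b \<le> \<gamma>" "g = prec (Suc b) \<or> g = succ (Suc b)"
  proof -
    obtain b where "b \<in> {1..\<gamma>}" "g = prec b \<or> g = succ b"
      using assms by (auto simp: dendr_gens'_def)
    then show thesis using that by (cases b) auto
  qed
  then show ?thesis using prec succ by auto
qed

lemma op_subst_id_corolla: "g \<in> dendr_gens' \<gamma> \<Longrightarrow> op_subst (\<lambda>g. g) (corolla g) = g"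
  by (rule op_subst_corolla[OF dendr_gens'_closed])

lemma op_subst_id_dendr_gen_diff:
  assumes "h \<in> dendr_gens \<gamma>"
  shows "op_subst (\<lambda>g. g) (dendr_gen_diff h) = (corolla h :: dendr_gen tree \<Rightarrow>\<^sub>0 'k::field)"
  using assms
proof (cases rule: dendr_gens_cases)
  case (1 a)
  then have "op_subst (\<lambda>g. g) (dendr_gen_diff h) = (prec (Suc a) - prec a :: dendr_gen tree \<Rightarrow>\<^sub>0 'k)"
    by (auto simp: op_subst.diff op_subst_id_corolla[of _ \<gamma>] dendr_gens'_def)
  then show ?thesis by (simp add: 1 prec_Suc)
next
  case (2 a)
  then have "op_subst (\<lambda>g. g) (dendr_gen_diff h) = (succ (Suc a) - succ a :: dendr_gen tree \<Rightarrow>\<^sub>0 'k)"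
    by (auto simp: op_subst.diff op_subst_id_corolla[of _ \<gamma>] dendr_gens'_def)
  then show ?thesis by (simp add: 2 succ_Suc)
qed

lemma independent_dendr_gens':
  "lincomb.independent (dendr_gens' \<gamma> :: (dendr_gen tree \<Rightarrow>\<^sub>0 'k::field) set)"
proof
  let ?G = "dendr_gens' \<gamma> :: (dendr_gen tree \<Rightarrow>\<^sub>0 'k) set"
  assume "lincomb.dependent ?G"
  then obtain g where g: "g \<in> ?G" "g \<in> lincomb.span (?G - {g})"
    by (auto simp: lincomb.dependent_def)
  let ?t = "\<langle>\<langle>\<rangle>, g, \<langle>\<rangle>\<rangle>"
  let ?V = "{x :: (dendr_gen tree \<Rightarrow>\<^sub>0 'k) tree \<Rightarrow>\<^sub>0 'k. Poly_Mapping.lookup x ?t = 0}"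
  have "lincomb.span (op_subst dendr_gen_diff ` (?G - {g})) \<subseteq> ?V"
  proof (rule lincomb.span_minimal)
    show "lincomb.subspace ?V"
      by (auto intro!: lincomb.subspaceI simp: lookup_add)
    show "op_subst dendr_gen_diff ` (?G - {g}) \<subseteq> ?V"
      by (auto simp: op_subst_dendr_gen_diff corolla_def lookup_single when_def)
  qed
  moreover have "corolla g \<in> lincomb.span (op_subst dendr_gen_diff ` (?G - {g}))"
    unfolding op_subst.span_image
    by (rule image_eqI[where x = g]) (simp_all only: op_subst_dendr_gen_diff[OF g(1)] g(2))
  ultimately have "corolla g \<in> ?V" by blast
  then show False by (simp add: corolla_def)
qed

theorem theorem2p1p4:
  fixes \<gamma> :: nat
  shows
    "lincomb.independent (dendr_gens' \<gamma> :: (dendr_gen tree \<Rightarrow>\<^sub>0 'k::field_char_0) set) \<and>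
     lincomb.span (dendr_gens' \<gamma> :: (dendr_gen tree \<Rightarrow>\<^sub>0 'k) set) =
       ops (free_operad (dendr_gens \<gamma>)) 2 \<and>
     dendr_relations' \<gamma> prec succ = (dendr_relations \<gamma> :: (dendr_gen tree \<Rightarrow>\<^sub>0 'k) set) \<and>
     (let G' = dendr_gens' \<gamma> :: (dendr_gen tree \<Rightarrow>\<^sub>0 'k) set;
          R' = dendr_relations' \<gamma> (\<lambda>b. corolla (prec b)) (\<lambda>b. corolla (succ b))
      in \<exists>\<Phi>. operad_iso \<Phi> (presented_operad G' R') (Dendr \<gamma> :: (_, 'k) operad_data) \<and>
             (\<forall>g \<in> G'. \<Phi> 2 (presented_class G' R' 2 (corolla g)) =
                presented_class (dendr_gens \<gamma>) (dendr_relations \<gamma>) 2 g))"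
proof -
  define G' where "G' = (dendr_gens' \<gamma> :: (dendr_gen tree \<Rightarrow>\<^sub>0 'k) set)"
  define R' where "R' = (dendr_relations' \<gamma> (\<lambda>b. corolla (prec b)) (\<lambda>b. corolla (succ b)) ::
    ((dendr_gen tree \<Rightarrow>\<^sub>0 'k) tree \<Rightarrow>\<^sub>0 'k) set)"
  let ?F' = "free_operad G' :: (_, 'k) operad_data"
  let ?F = "free_operad (dendr_gens \<gamma>) :: (_, 'k) operad_data"
  let ?\<Psi> = "op_subst (\<lambda>g. g) :: _ \<Rightarrow> (dendr_gen tree \<Rightarrow>\<^sub>0 'k)"
  define I where "I = generated_ideal ?F' R'"
  have iso: "operad_iso (\<lambda>_. ?\<Psi>) ?F' ?F"
    unfolding G'_def
    by (rule operad_iso_op_subst[where f' = dendr_gen_diff])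
       (simp_all add: dendr_gens'_closed dendr_gen_diff_closed op_subst_dendr_gen_diff
         op_subst_id_dendr_gen_diff)
  have gens: "prec b \<in> G'" "succ b \<in> G'" if "b \<in> {1..\<gamma>}" for b
    using that by (simp_all add: G'_def dendr_gens'_def)
  have corolla: "?\<Psi> (corolla g) = g" if "g \<in> G'" for g
    using op_subst_id_corolla that unfolding G'_def .
  have R': "R' \<subseteq> ops ?F' 3"
    unfolding R'_def by (intro dendr_relations'_closed corolla_closed gens)
  have "?\<Psi> ` R' = dendr_relations' \<gamma> prec succ"
    unfolding R'_def
    by (rule op_subst_dendr_relations'[where G = G' and H = "dendr_gens \<gamma>"])
       (simp_all add: G'_def dendr_gens'_closed corolla gens[unfolded G'_def] corolla_closed
         corolla[unfolded G'_def] del: atLeastAtMost_iff)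
  then have rels: "?\<Psi> ` R' = dendr_relations \<gamma>"
    by (simp add: dendr_relations'_prec_succ)
  have I: "I n \<subseteq> ops ?F' n" for n
    unfolding I_def by (rule generated_ideal_subset[OF ns_operad_free_operad R'])
  have ideal: "(\<lambda>n. ?\<Psi> ` I n) = generated_ideal ?F (dendr_relations \<gamma>)"
    unfolding I_def rels[symmetric]
    using image_generated_ideal[OF iso ns_operad_free_operad ns_operad_free_operad R'] by blast
  have "operad_iso (\<lambda>_. (`) ?\<Psi>) (presented_operad G' R') (Dendr \<gamma>)"
    using operad_iso_quotient[OF iso ns_operad_free_operad I]
    unfolding Dendr_def presented_operad_def ideal unfolding I_def .
  moreover have "?\<Psi> ` presented_class G' R' 2 (corolla g) =
      presented_class (dendr_gens \<gamma>) (dendr_relations \<gamma>) 2 g" if "g \<in> G'" for g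
    using image_operad_coset[where I = I, OF iso I corolla_closed[OF that]]
    unfolding presented_class_def ideal unfolding I_def by (simp add: corolla that)
  ultimately have "\<exists>\<Phi>. operad_iso \<Phi> (presented_operad G' R') (Dendr \<gamma> :: (_, 'k) operad_data) \<and>
      (\<forall>g \<in> G'. \<Phi> 2 (presented_class G' R' 2 (corolla g)) =
        presented_class (dendr_gens \<gamma>) (dendr_relations \<gamma>) 2 g)"
    by (intro exI[of _ "\<lambda>_. (`) ?\<Psi>"]) blast
  then show ?thesis
    unfolding Let_def G'_def R'_def
    by (intro conjI independent_dendr_gens' span_dendr_gens' dendr_relations'_prec_succ)
qed

end
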